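(* Let $\alpha\ge0$ and let $f=h+\overline{g}\in\mathcal{W}^0_{\mathcal{H}}(\alpha)$ with $h(z)=z+\sum_{n=2}^\infty a_nz^n$ and $g(z)=\sum_{n=2}^\infty b_nz^n$. Then for $n\ge2$, $$|b_n|\le\frac{1}{\alpha n^2+n(1-\alpha)}.$$ The result is sharp for the function $f(z)=z+\frac{1}{\alpha n^2+n(1-\alpha)}\overline{z^n}$ (that is, for each $n\ge 2$ this function belongs to $\mathcal{W}^0_{\mathcal{H}}(\alpha)$ and attains equality).
   Context: $\mathbb{D}=\{z\in\mathbb{C}:|z|<1\}$. $\mathcal{H}$ is the class of complex-valued harmonic functions $f$ in $\mathbb{D}$ with $f(0)=0$ and $f_z(0)=1$; each has the canonical representation $f=h+\overline{g}$ with $h(z)=z+\sum_{n\ge2}a_nz^n$ and $g(z)=\sum_{n\ge1}b_nz^n$ analytic in $\mathbb{D}$. For $\alpha\ge0$, $\mathcal{W}^0_{\mathcal{H}}(\alpha)$ is the class of $f=h+\overline{g}\in\mathcal{H}$ with $g'(0)=0$ and $\mathrm{Re}(h'(z)+\alpha zh''(z))>|g'(z)+\alpha zg''(z)|$ for all $z\in\mathbb{D}$. *)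

theory Defs
  imports "HOL-Complex_Analysis.Complex_Analysis"
begin

abbreviation unit_disk :: "complex set" where
  "unit_disk \<equiv> ball 0 1"

text \<open>The real directional derivative in direction \<open>v\<close>; the directions \<open>1\<close> and \<open>\<i>\<close>
  give the partial derivatives in \<open>x\<close> and \<open>y\<close>, where \<open>z = x + \<i> y\<close>.\<close>

definition dir_deriv :: "complex \<Rightarrow> (complex \<Rightarrow> complex) \<Rightarrow> complex \<Rightarrow> complex" where
  "dir_deriv v f z = vector_derivative (\<lambda>t::real. f (z + of_real t * v)) (at 0)"

definition C1_on :: "complex set \<Rightarrow> (complex \<Rightarrow> complex) \<Rightarrow> bool" where
  "C1_on S f \<longleftrightarrow> (\<forall>v\<in>{1, \<i>}.
     (\<forall>z\<in>S. (\<lambda>t::real. f (z + of_real t * v)) differentiable (at 0)) \<and>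
     continuous_on S (dir_deriv v f))"

definition C2_on :: "complex set \<Rightarrow> (complex \<Rightarrow> complex) \<Rightarrow> bool" where
  "C2_on S f \<longleftrightarrow> C1_on S f \<and> C1_on S (dir_deriv 1 f) \<and> C1_on S (dir_deriv \<i> f)"

text \<open>Only meant for open \<open>S\<close>.\<close>

definition harmonic_on :: "complex set \<Rightarrow> (complex \<Rightarrow> complex) \<Rightarrow> bool" where
  "harmonic_on S f \<longleftrightarrow> C2_on S f \<and>
     (\<forall>z\<in>S. dir_deriv 1 (dir_deriv 1 f) z + dir_deriv \<i> (dir_deriv \<i> f) z = 0)"

text \<open>The Wirtinger derivative \<open>f\<^sub>z = (f\<^sub>x - \<i> f\<^sub>y) / 2\<close>.\<close>

definition wirtinger :: "(complex \<Rightarrow> complex) \<Rightarrow> complex \<Rightarrow> complex" where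
  "wirtinger f z = (dir_deriv 1 f z - \<i> * dir_deriv \<i> f z) / 2"

definition class_H :: "(complex \<Rightarrow> complex) set" where
  "class_H = {f. harmonic_on unit_disk f \<and> f 0 = 0 \<and> wirtinger f 0 = 1}"

text \<open>The condition \<open>g 0 = 0\<close> makes the decomposition \<open>f = h + cnj g\<close> unique on the disk.\<close>

definition canonical_rep ::
    "(complex \<Rightarrow> complex) \<Rightarrow> (complex \<Rightarrow> complex) \<Rightarrow> (complex \<Rightarrow> complex) \<Rightarrow> bool" where
  "canonical_rep f h g \<longleftrightarrow>
     h holomorphic_on unit_disk \<and> g holomorphic_on unit_disk \<and> g 0 = 0 \<and>
     (\<forall>z\<in>unit_disk. f z = h z + cnj (g z))"

definition class_W0 :: "real \<Rightarrow> (complex \<Rightarrow> complex) set" where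
  "class_W0 \<alpha> = {f \<in> class_H. \<exists>h g. canonical_rep f h g \<and> deriv g 0 = 0 \<and>
     (\<forall>z\<in>unit_disk. Re (deriv h z + of_real \<alpha> * z * deriv (deriv h) z)
                  > cmod (deriv g z + of_real \<alpha> * z * deriv (deriv g) z))}"

text \<open>\<open>h z = z + (\<Sum>n\<ge>2. a\<^sub>n z\<^sup>n)\<close> and \<open>g z = (\<Sum>n\<ge>2. b\<^sub>n z\<^sup>n)\<close> on the disk;
  the values of \<open>a\<close> and \<open>b\<close> at \<open>0\<close> and \<open>1\<close> are irrelevant.\<close>

definition power_series_rep ::
    "(complex \<Rightarrow> complex) \<Rightarrow> (complex \<Rightarrow> complex) \<Rightarrow> (nat \<Rightarrow> complex) \<Rightarrow> (nat \<Rightarrow> complex) \<Rightarrow> bool" where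
  "power_series_rep h g a b \<longleftrightarrow> (\<forall>z\<in>unit_disk.
     (\<lambda>n. a (n + 2) * z ^ (n + 2)) sums (h z - z) \<and>
     (\<lambda>n. b (n + 2) * z ^ (n + 2)) sums g z)"

end

(* Writing G = g' + \<alpha> z g'' and H = h' + \<alpha> z h'', the coefficient of z^(n-1) in G is
   (\<alpha> n^2 + n (1 - \<alpha>)) b_n. By Cauchy's formula on |z| = r, this coefficient times r^(n-1) is
   at most the mean of |G|, hence at most the mean of Re H, which is Re H(0) = h'(0) = 1;
   then let r tend to 1. *)

theory Submission
  imports Defs
begin

section \<open>Coefficient estimates by domination\<close>

text \<open>Cauchy's formula is applied on the boundary circle itself, so continuity is asked up to
  the circle and the domination only on it.\<close>

lemma norm_higher_deriv_le_Re_centre: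
  assumes r: "0 < r"
    and cG: "continuous_on (cball 0 r) G" and hG: "G holomorphic_on ball 0 r"
    and cH: "continuous_on (cball 0 r) H" and hH: "H holomorphic_on ball 0 r"
    and le: "\<And>z. cmod z = r \<Longrightarrow> cmod (G z) \<le> Re (H z)"
  shows "cmod ((deriv ^^ m) G 0 / fact m) * r ^ m \<le> Re (H 0)"
proof -
  define w where "w t = circlepath 0 r t" for t
  have w: "cmod (w t) = r" "w t \<noteq> 0" for t
    using r by (auto simp: w_def circlepath norm_mult)
  have vd: "vector_derivative (circlepath 0 r) (at t within {0..1}) = 2 * pi * \<i> * w t"
    if "t \<in> {0..1}" for t
    using that vector_derivative_circlepath01[of t 0 r] by (simp add: w_def circlepath)
  \<comment> \<open>Cauchy's formula for the \<open>k\<close>-th derivative, written as a mean over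
    \<open>t\<close>: the velocity of the circle cancels the factor 2 pi i and one power of
    \<open>w t\<close>. It serves \<open>G\<close> with exponent \<open>m\<close> and, with exponent
    0, gives the mean value property of \<open>H\<close>.\<close>
  have int: "((\<lambda>t. F (w t) / w t ^ k) has_integral (deriv ^^ k) F 0 / fact k) {0..1}"
    if "continuous_on (cball 0 r) F" "F holomorphic_on ball 0 r" for F k
  proof -
    have "((\<lambda>u. F u / (u - 0) ^ Suc k) has_contour_integral
            2 * pi * \<i> / fact k * (deriv ^^ k) F 0) (circlepath 0 r)"
      by (rule Cauchy_has_contour_integral_higher_derivative_circlepath) (use that r in auto)
    then have "((\<lambda>t. F (w t) / w t ^ Suc k * (2 * pi * \<i> * w t)) has_integral
            2 * pi * \<i> / fact k * (deriv ^^ k) F 0) {0..1}"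
      unfolding has_contour_integral_def
      by (rule has_integral_eq[rotated]) (simp add: vd w_def)
    then have "((\<lambda>t. 1 / (2 * pi * \<i>) * (F (w t) / w t ^ Suc k * (2 * pi * \<i> * w t))) has_integral
            1 / (2 * pi * \<i>) * (2 * pi * \<i> / fact k * (deriv ^^ k) F 0)) {0..1}"
      by (rule has_integral_mult_right)
    then show ?thesis
      by (rule has_integral_eq_rhs[OF has_integral_eq, rotated]) (use w in \<open>auto simp: field_simps\<close>)
  qed
  have "((\<lambda>t. H (w t)) has_integral H 0) {0..1}"
    using int[OF cH hH, of 0] by simp
  from has_integral_linear[OF this bounded_linear_Re]
  have "((\<lambda>t. Re (H (w t))) has_integral Re (H 0)) {0..1}"
    by (simp add: o_def)
  \<comment> \<open>Since the modulus of \<open>w t ^ m\<close> is the constant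
    \<open>r ^ m\<close>, this integrand dominates that of \<open>G\<close> pointwise.\<close>
  from has_integral_divide[OF this, of "r ^ m"]
  have H: "((\<lambda>t. Re (H (w t)) / r ^ m) has_integral Re (H 0) / r ^ m) {0..1}" .
  note G = int[OF cG hG, of m]
  have "norm (integral {0..1} (\<lambda>t. G (w t) / w t ^ m)) \<le> integral {0..1} (\<lambda>t. Re (H (w t)) / r ^ m)"
    by (rule integral_norm_bound_integral)
      (use G H r le w in \<open>auto simp: norm_divide norm_power divide_right_mono has_integral_integrable_integral\<close>)
  then have "cmod ((deriv ^^ m) G 0 / fact m) \<le> Re (H 0) / r ^ m"
    by (simp only: integral_unique[OF G] integral_unique[OF H])
  then show ?thesis
    using r by (simp add: pos_le_divide_eq)
qed

lemma norm_coeff_le_Re_centre: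
  assumes G: "G holomorphic_on unit_disk" and H: "H holomorphic_on unit_disk"
    and le: "\<And>z. z \<in> unit_disk \<Longrightarrow> cmod (G z) \<le> Re (H z)"
  shows "cmod ((deriv ^^ m) G 0 / fact m) \<le> Re (H 0)"
proof (rule tendsto_upperbound)
  let ?c = "cmod ((deriv ^^ m) G 0 / fact m)"
  have "((\<lambda>r. ?c * r ^ m) \<longlongrightarrow> ?c * 1 ^ m) (at_left 1)"
    by (intro tendsto_intros)
  then show "((\<lambda>r. ?c * r ^ m) \<longlongrightarrow> ?c) (at_left 1)" by simp
  have "?c * r ^ m \<le> Re (H 0)" if "0 < r" "r < 1" for r
  proof (rule norm_higher_deriv_le_Re_centre)
    have sub: "cball 0 r \<subseteq> unit_disk" "ball 0 r \<subseteq> unit_disk"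
      using that by auto
    show "continuous_on (cball 0 r) G" "continuous_on (cball 0 r) H"
      "G holomorphic_on ball 0 r" "H holomorphic_on ball 0 r"
      using G H sub by (auto intro: holomorphic_on_subset holomorphic_on_imp_continuous_on)
  qed (use that le in auto)
  moreover have "\<forall>\<^sub>F r in at_left (1::real). r \<in> {0<..<1}"
    by (rule eventually_at_leftI[of 0]) auto
  ultimately show "\<forall>\<^sub>F r in at_left 1. ?c * r ^ m \<le> Re (H 0)"
    by (auto elim: eventually_mono)
qed auto

section \<open>Uniqueness of the canonical representation\<close>

text \<open>The real differential of \<open>k\<close> is complex linear, and also conjugate linear
  because it is that of \<open>cnj\<close> after \<open>l\<close>. Only the zero map is both, as its
  values at 1 and \<open>\<i>\<close> show.\<close>

lemma holomorphic_eq_cnj_imp_constant: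
  assumes "open S" "connected S" "k holomorphic_on S" "l holomorphic_on S"
    and eq: "\<And>z. z \<in> S \<Longrightarrow> k z = cnj (l z)"
  shows "k constant_on S"
proof (rule has_field_derivative_0_imp_constant_on)
  fix z assume z: "z \<in> S"
  have k: "(k has_derivative (*) (deriv k z)) (at z)"
    using holomorphic_derivI[OF assms(3,1) z] by (simp add: has_field_derivative_def)
  have l: "(l has_derivative (*) (deriv l z)) (at z)"
    using holomorphic_derivI[OF assms(4,1) z] by (simp add: has_field_derivative_def)
  have "((\<lambda>z. cnj (l z)) has_derivative (\<lambda>v. cnj (deriv l z * v))) (at z)"
    by (rule bounded_linear.has_derivative[OF bounded_linear_cnj l])
  then have "(k has_derivative (\<lambda>v. cnj (deriv l z * v))) (at z)"
    by (rule has_derivative_transform_within_open[OF _ assms(1) z]) (use eq in auto)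
  then have "(*) (deriv k z) = (\<lambda>v. cnj (deriv l z * v))"
    using k has_derivative_unique by blast
  from fun_cong[OF this, of 1] fun_cong[OF this, of \<i>] have "deriv k z = 0"
    by (simp add: complex_eq_iff)
  then show "(k has_field_derivative 0) (at z)"
    using holomorphic_derivI[OF assms(3,1) z] by simp
qed (use assms in auto)

text \<open>\<open>class_W0\<close> only provides some decomposition satisfying the inequality; this
  lemma identifies it with the one whose coefficients are to be bounded. The difference of the
  analytic parts is constant, and the normalisation of \<open>g\<close> and \<open>g'\<close> at 0
  makes the constant vanish. The primes mark a second decomposition, not derivatives.\<close>

lemma canonical_rep_unique:
  assumes "canonical_rep f h g" "canonical_rep f h' g'" "z \<in> unit_disk"
  shows "h z = h' z" "g z = g' z"
proof -
  have eq: "h z - h' z = cnj (g' z - g z)" if "z \<in> unit_disk" for z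
  proof -
    have "h z + cnj (g z) = h' z + cnj (g' z)"
      using assms(1,2) that unfolding canonical_rep_def by metis
    then show ?thesis by (simp add: algebra_simps)
  qed
  have "(\<lambda>z. h z - h' z) constant_on unit_disk"
    by (rule holomorphic_eq_cnj_imp_constant[where l = "\<lambda>z. g' z - g z"])
      (use assms eq in \<open>auto simp: canonical_rep_def intro!: holomorphic_intros\<close>)
  then obtain c where c: "\<And>z. z \<in> unit_disk \<Longrightarrow> h z - h' z = c"
    by (auto simp: constant_on_def)
  have "c = 0"
    using c[of 0] eq[of 0] assms by (simp add: canonical_rep_def)
  then show "h z = h' z" using c[OF assms(3)] by simp
  then show "g z = g' z" using eq[OF assms(3)] by (simp flip: complex_cnj_diff)
qed

section \<open>From power series to the coefficient bound\<close>

text \<open>This gives access to formal power series, where the coefficients of the differential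
  expression in \<open>g\<close> can be computed by rules.\<close>

lemma sums_imp_has_fps_expansion:
  fixes f :: "complex \<Rightarrow> complex"
  assumes "0 < r" "\<And>z. z \<in> ball 0 r \<Longrightarrow> (\<lambda>n. c n * z ^ n) sums f z"
  shows "f has_fps_expansion Abs_fps c"
proof (rule has_fps_expansionI)
  have "\<forall>\<^sub>F z in nhds 0. z \<in> ball 0 r"
    by (intro eventually_nhds_in_open) (use assms in auto)
  then show "\<forall>\<^sub>F z in nhds 0. (\<lambda>n. fps_nth (Abs_fps c) n * z ^ n) sums f z"
    by eventually_elim (use assms in simp)
qed

text \<open>The weight is the factor in the image of \<open>z ^ n\<close> under g' + \<alpha> z g'',
  namely n + \<alpha> n (n - 1).\<close>

lemma coefficient_weight_pos:
  assumes "\<alpha> \<ge> 0" "n \<ge> 1"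
  shows "\<alpha> * (real n)\<^sup>2 + real n * (1 - \<alpha>) > 0"
proof -
  have "\<alpha> * (real n)\<^sup>2 + real n * (1 - \<alpha>) = real n * (1 + \<alpha> * (real n - 1))"
    by (simp add: algebra_simps power2_eq_square)
  then show ?thesis using assms by (simp add: add_pos_nonneg)
qed

lemma coefficient_bound:
  assumes \<alpha>: "\<alpha> \<ge> 0" and f: "f \<in> class_W0 \<alpha>" and rep: "canonical_rep f h g"
    and ps: "power_series_rep h g a b" and n: "n \<ge> 2"
  shows "cmod (b n) \<le> 1 / (\<alpha> * (real n)\<^sup>2 + real n * (1 - \<alpha>))"
proof -
  obtain h0 g0 where rep0: "canonical_rep f h0 g0"
    and lt: "\<And>z. z \<in> unit_disk \<Longrightarrow> cmod (deriv g0 z + of_real \<alpha> * z * deriv (deriv g0) z)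
             < Re (deriv h0 z + of_real \<alpha> * z * deriv (deriv h0) z)"
    using f unfolding class_W0_def by auto
  \<comment> \<open>\<open>power_series_rep\<close> leaves the entries of \<open>a\<close> and
    \<open>b\<close> at 0 and 1 free. Here they are replaced by the true Taylor coefficients: 0 and
    1 for \<open>h\<close>, 0 and 0 for \<open>g\<close>.\<close>
  define ca where "ca k = (if k = 0 then 0 else if k = 1 then 1 else a k)" for k
  define cb where "cb k = (if k < 2 then 0 else b k)" for k
  have h0: "h0 has_fps_expansion Abs_fps ca"
  proof (rule sums_imp_has_fps_expansion[OF zero_less_one])
    fix z assume z: "z \<in> unit_disk"
    have "(\<lambda>k. ca (k + 2) * z ^ (k + 2)) sums (h0 z - (\<Sum>i<2. ca i * z ^ i))"
      using ps z canonical_rep_unique[OF rep rep0 z, symmetric]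
      by (simp add: power_series_rep_def ca_def numeral_2_eq_2)
    then show "(\<lambda>k. ca k * z ^ k) sums h0 z"
      by (rule iffD1[OF sums_iff_shift'[of "\<lambda>k. ca k * z ^ k"]])
  qed
  have g0: "g0 has_fps_expansion Abs_fps cb"
  proof (rule sums_imp_has_fps_expansion[OF zero_less_one])
    fix z assume z: "z \<in> unit_disk"
    have "(\<lambda>k. cb (k + 2) * z ^ (k + 2)) sums (g0 z - (\<Sum>i<2. cb i * z ^ i))"
      using ps z canonical_rep_unique[OF rep rep0 z, symmetric]
      by (simp add: power_series_rep_def cb_def numeral_2_eq_2)
    then show "(\<lambda>k. cb k * z ^ k) sums g0 z"
      by (rule iffD1[OF sums_iff_shift'[of "\<lambda>k. cb k * z ^ k"]])
  qed
  define G where "G z = deriv g0 z + of_real \<alpha> * (z * deriv (deriv g0) z)" for z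
  define H where "H z = deriv h0 z + of_real \<alpha> * (z * deriv (deriv h0) z)" for z
  have hol: "g0 holomorphic_on unit_disk" "h0 holomorphic_on unit_disk"
    using rep0 by (auto simp: canonical_rep_def)
  have "G has_fps_expansion fps_deriv (Abs_fps cb) +
          fps_const (of_real \<alpha>) * (fps_X * fps_deriv (fps_deriv (Abs_fps cb)))"
    unfolding G_def by (intro fps_expansion_intros g0)
  \<comment> \<open>Differentiation lowers the index by one, so \<open>b n\<close> sits at
    \<open>n - 1\<close>. As \<open>n\<close> is at least 2, \<open>cb n\<close> is
    \<open>b n\<close> and the factor \<open>fps_X\<close> contributes no exceptional zero
    term.\<close>
  from fps_nth_fps_expansion[OF this, of "n - 1"] n
  have "(deriv ^^ (n - 1)) G 0 / fact (n - 1) =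
          of_nat n * b n + of_real \<alpha> * (of_nat (n - 1) * (of_nat n * b n))"
    by (auto simp: cb_def numeral_2_eq_2 le_Suc_eq dest!: le_Suc_ex)
  also have "\<dots> = of_real (\<alpha> * (real n)\<^sup>2 + real n * (1 - \<alpha>)) * b n"
    using n by (simp add: of_nat_diff algebra_simps power2_eq_square)
  finally have coeff: "cmod ((deriv ^^ (n - 1)) G 0 / fact (n - 1)) =
      \<bar>\<alpha> * (real n)\<^sup>2 + real n * (1 - \<alpha>)\<bar> * cmod (b n)"
    by (simp only: norm_mult norm_of_real)
  have "cmod ((deriv ^^ (n - 1)) G 0 / fact (n - 1)) \<le> Re (H 0)"
    by (rule norm_coeff_le_Re_centre)
      (use lt in \<open>auto simp: G_def[abs_def] H_def[abs_def] mult.assoc less_imp_le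
          intro!: holomorphic_intros hol\<close>)
  also have "H 0 = 1"
    using fps_nth_fps_expansion[OF h0, of 1] by (simp add: H_def ca_def)
  finally show ?thesis
    using coefficient_weight_pos[OF \<alpha>, of n] n coeff by (simp add: pos_le_divide_eq mult.commute)
qed

section \<open>Harmonicity of a holomorphic plus an antiholomorphic function\<close>

lemma has_vector_derivative_add_cnj:
  assumes "open S" "z \<in> S" "P holomorphic_on S" "Q holomorphic_on S"
    and f: "\<And>z. z \<in> S \<Longrightarrow> f z = P z + cnj (Q z)"
  shows "((\<lambda>t::real. f (z + of_real t * v)) has_vector_derivative
           v * deriv P z + cnj (v * deriv Q z)) (at 0)"
proof -
  have line: "((\<lambda>t::real. z + of_real t * v) has_vector_derivative v) (at 0)"
    by (auto intro!: derivative_eq_intros)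
  have comp: "((\<lambda>t::real. F (z + of_real t * v)) has_vector_derivative v * deriv F z) (at 0)"
    if "F holomorphic_on S" for F
    using field_vector_diff_chain_at[OF line, of F "deriv F z"]
      holomorphic_derivI[OF that assms(1,2)] by (simp add: o_def)
  have "((\<lambda>t::real. P (z + of_real t * v) + cnj (Q (z + of_real t * v))) has_vector_derivative
           v * deriv P z + cnj (v * deriv Q z)) (at 0)"
    by (intro has_vector_derivative_add comp assms has_vector_derivative_cnj)
  \<comment> \<open>The formula for \<open>f\<close> is known only on \<open>S\<close>, so the
    derivative transfers on the open set of parameters whose points lie in \<open>S\<close>.\<close>
  moreover have "open ((\<lambda>t::real. z + of_real t * v) -` S)"
    by (intro open_vimage continuous_intros assms)
  ultimately show ?thesis
    by (rule has_vector_derivative_transform_within_open) (use assms in auto)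
qed

text \<open>The derivative in direction \<open>v\<close> again has the form holomorphic plus
  conjugate of holomorphic, so both conclusions can be applied to it in turn to reach second
  derivatives.\<close>

lemma
  assumes "open S" "P holomorphic_on S" "Q holomorphic_on S"
    and "\<And>z. z \<in> S \<Longrightarrow> f z = P z + cnj (Q z)"
  shows dir_deriv_add_cnj:
      "z \<in> S \<Longrightarrow> dir_deriv v f z = v * deriv P z + cnj (v * deriv Q z)"
    and C1_on_add_cnj: "C1_on S f"
proof -
  have vd: "((\<lambda>t::real. f (z + of_real t * v)) has_vector_derivative
           v * deriv P z + cnj (v * deriv Q z)) (at 0)" if "z \<in> S" for z v
    by (rule has_vector_derivative_add_cnj) (use assms that in auto)
  then show dd: "dir_deriv v f z = v * deriv P z + cnj (v * deriv Q z)" if "z \<in> S" for z v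
    using that by (simp add: dir_deriv_def vector_derivative_at)
  have "continuous_on S (\<lambda>z. v * deriv P z + cnj (v * deriv Q z))" for v
    by (intro continuous_intros holomorphic_on_imp_continuous_on holomorphic_deriv assms)
  then have "continuous_on S (dir_deriv v f)" for v
    using dd by (simp cong: continuous_on_cong)
  then show "C1_on S f"
    unfolding C1_on_def using vd[THEN differentiableI_vector] by blast
qed

text \<open>Differentiating twice in direction \<open>v\<close> multiplies the second derivatives of
  \<open>P\<close> and \<open>Q\<close> by the square of \<open>v\<close>. The squares of 1 and
  \<open>\<i>\<close> add up to 0, so the Laplacian vanishes.\<close>

lemma harmonic_on_add_cnj:
  assumes S: "open S" and P: "P holomorphic_on S" and Q: "Q holomorphic_on S"
    and f: "\<And>z. z \<in> S \<Longrightarrow> f z = P z + cnj (Q z)"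
  shows "harmonic_on S f"
proof -
  have dd: "dir_deriv v f z = v * deriv P z + cnj (v * deriv Q z)" if "z \<in> S" for z v
    by (rule dir_deriv_add_cnj) (use assms that in auto)
  have hol: "(\<lambda>z. v * deriv P z) holomorphic_on S" "(\<lambda>z. v * deriv Q z) holomorphic_on S" for v
    by (intro holomorphic_intros P Q S)+
  have C1: "C1_on S (dir_deriv v f)" for v
    by (rule C1_on_add_cnj[OF S hol]) (rule dd)
  have "dir_deriv v (dir_deriv v f) z = v * deriv (\<lambda>z. v * deriv P z) z + cnj (v * deriv (\<lambda>z. v * deriv Q z) z)"
    if "z \<in> S" for z v
    by (rule dir_deriv_add_cnj[OF S hol]) (use dd that in auto)
  moreover have "deriv (\<lambda>z. v * deriv F z) z = v * deriv (deriv F) z"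
    if "F holomorphic_on S" "z \<in> S" for F v z
    by (rule deriv_cmult) (use that S holomorphic_deriv holomorphic_on_imp_differentiable_at in blast)
  ultimately have "dir_deriv v (dir_deriv v f) z = v\<^sup>2 * deriv (deriv P) z + cnj (v\<^sup>2 * deriv (deriv Q) z)"
    if "z \<in> S" for z v
    using that P Q by (simp add: power2_eq_square mult.assoc)
  then show ?thesis
    unfolding harmonic_on_def C2_on_def using C1 C1_on_add_cnj[OF assms] by simp
qed

lemma wirtinger_add_cnj:
  assumes "open S" "P holomorphic_on S" "Q holomorphic_on S"
    and "\<And>z. z \<in> S \<Longrightarrow> f z = P z + cnj (Q z)" "z \<in> S"
  shows "wirtinger f z = deriv P z"
  using dir_deriv_add_cnj[OF assms(1-4)] assms(5)
  by (simp add: wirtinger_def algebra_simps)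

section \<open>Sharpness\<close>

text \<open>With \<open>h\<close> the identity and \<open>g\<close> the monomial
  \<open>c * z ^ n\<close>, the expression in \<open>h\<close> is 1. Since \<open>c\<close> is the
  reciprocal of the weight, the one in \<open>g\<close> is exactly \<open>z ^ (n - 1)\<close>, of
  modulus below 1 on the open disk because \<open>n\<close> is at least 2.\<close>

lemma extremal_function:
  fixes \<alpha> :: real and n :: nat
  defines "c \<equiv> 1 / (\<alpha> * (real n)\<^sup>2 + real n * (1 - \<alpha>))"
  assumes \<alpha>: "\<alpha> \<ge> 0" and n: "n \<ge> 2" and f: "f = (\<lambda>z. z + of_real c * cnj (z ^ n))"
  shows "f \<in> class_W0 \<alpha>" and "\<exists>h g a b. canonical_rep f h g \<and> power_series_rep h g a b \<and> cmod (b n) = c"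
proof -
  define g where "g z = of_real c * z ^ n" for z :: complex
  have c: "c > 0"
    using coefficient_weight_pos[OF \<alpha>, of n] n by (simp add: c_def)
  have hol: "(\<lambda>z. z) holomorphic_on A" "g holomorphic_on A" for A
    unfolding g_def by (intro holomorphic_intros)+
  have rep: "canonical_rep f (\<lambda>z. z) g"
    unfolding canonical_rep_def using hol n by (simp add: f g_def)
  have d1: "deriv g = (\<lambda>z. of_real c * of_nat n * z ^ (n - 1))"
    unfolding g_def
    by (intro ext DERIV_imp_deriv) (auto intro!: derivative_eq_intros)
  have d2: "deriv (deriv g) = (\<lambda>z. of_real c * of_nat n * of_nat (n - 1) * z ^ (n - 2))"
    unfolding d1
    by (intro ext DERIV_imp_deriv) (auto intro!: derivative_eq_intros simp: diff_diff_eq numeral_2_eq_2)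
  have fz: "f z = z + cnj (g z)" for z
    by (simp add: f g_def)
  have "harmonic_on unit_disk f" "wirtinger f 0 = 1"
    using harmonic_on_add_cnj[of unit_disk "\<lambda>z. z" g f]
      wirtinger_add_cnj[of unit_disk "\<lambda>z. z" g f 0] hol fz by auto
  then have "f \<in> class_H"
    using n by (simp add: class_H_def f)
  moreover have "cmod (deriv g z + of_real \<alpha> * z * deriv (deriv g) z) < 1" if z: "z \<in> unit_disk" for z
  proof -
    \<comment> \<open>This removes the truncated subtractions in the exponents and lets the factor
      \<open>z\<close> raise \<open>z ^ (n - 2)\<close> to \<open>z ^ (n - 1)\<close>.\<close>
    obtain k where k: "n = k + 2" using n by (metis le_add_diff_inverse2)
    have "deriv g z + of_real \<alpha> * z * deriv (deriv g) z =
        of_real (c * (\<alpha> * (real n)\<^sup>2 + real n * (1 - \<alpha>))) * z ^ (n - 1)"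
      unfolding d2 unfolding d1 k by (simp add: algebra_simps power2_eq_square)
    also have "c * (\<alpha> * (real n)\<^sup>2 + real n * (1 - \<alpha>)) = 1"
      using c by (simp add: c_def)
    finally show ?thesis
      using z n by (simp add: norm_power power_less_one_iff)
  qed
  moreover have "deriv g 0 = 0"
    using n by (simp add: d1)
  ultimately show "f \<in> class_W0 \<alpha>"
    unfolding class_W0_def using rep by (intro CollectI conjI exI[of _ "\<lambda>z. z"] exI[of _ g]) simp_all
  have "(\<lambda>k. (if k + 2 = n then of_real c else 0) * z ^ (k + 2)) sums g z" for z
  proof -
    have "(\<lambda>k. if k = n - 2 then of_real c * z ^ (k + 2) else 0) sums (of_real c * z ^ (n - 2 + 2))"
      by (rule sums_single)
    also have "(\<lambda>k. if k = n - 2 then of_real c * z ^ (k + 2) else 0) =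
        (\<lambda>k. (if k + 2 = n then of_real c else 0) * z ^ (k + 2))"
      using n by (intro ext) auto
    finally show ?thesis using n by (simp only: g_def le_add_diff_inverse2)
  qed
  \<comment> \<open>The series for \<open>h\<close> omits the term \<open>z\<close>, so all its
    coefficients are 0 here.\<close>
  then have "power_series_rep (\<lambda>z. z) g (\<lambda>_. 0) (\<lambda>k. if k = n then of_real c else 0)"
    by (simp add: power_series_rep_def)
  then show "\<exists>h g a b. canonical_rep f h g \<and> power_series_rep h g a b \<and> cmod (b n) = c"
    using rep c by (intro exI conjI) auto
qed

theorem theorem2p2:
  fixes \<alpha> :: real
  assumes "\<alpha> \<ge> 0"
  shows "(\<forall>f h g a b. f \<in> class_W0 \<alpha> \<and> canonical_rep f h g \<and> power_series_rep h g a b \<longrightarrow>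
            (\<forall>n\<ge>2. cmod (b n) \<le> 1 / (\<alpha> * (real n)\<^sup>2 + real n * (1 - \<alpha>)))) \<and>
         (\<forall>n\<ge>2. \<forall>f. f = (\<lambda>z. z + of_real (1 / (\<alpha> * (real n)\<^sup>2 + real n * (1 - \<alpha>))) * cnj (z ^ n)) \<longrightarrow>
            f \<in> class_W0 \<alpha> \<and>
            (\<exists>h g a b. canonical_rep f h g \<and> power_series_rep h g a b \<and>
               cmod (b n) = 1 / (\<alpha> * (real n)\<^sup>2 + real n * (1 - \<alpha>))))"
  using coefficient_bound[OF assms] extremal_function[OF assms] by blast

end
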